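(* For every $N\ge1$ and all positive integers $n_0,\ldots,n_N$, with $d_{\max}=\min_{i=1,\ldots,N}n_{i-1}n_i$, the DMT $$d_{\max}\,(1-r)^+$$ is achievable with the parallel AF scheme in the $(n_0,\ldots,n_N)$ multihop channel; that is, there is an independent parallel partition whose parallel AF scheme has this DMT.
   Context: Multihop channel: layers $0,\ldots,N$ with $n_i$ antenna nodes in layer $i$; the channel from layer $i-1$ to layer $i$ is $\mathbf H_i\in\mathbb C^{n_i\times n_{i-1}}$, the $\mathbf H_i$ being mutually independent with i.i.d. $\mathcal{CN}(0,1)$ entries. $(x)^+=\max(0,x)$. Partitions: each layer is partitioned into supernodes (sets of antenna nodes). An edge is the channel between two antenna nodes of adjacent layers. An AF path is a sequence of consecutive supernodes, one per layer, from source to destination, each performing amplify-and-forward (AF); up to power-normalization factors that do not affect the DMT it defines the MIMO channel given by the product of the corresponding sub-matrices of $\mathbf H_N,\ldots,\mathbf H_1$. A parallel partition is a set of AF paths, and it is independent if no two different AF paths share a common edge. In the parallel AF scheme with a partition of $K$ AF paths, a data frame of length $KT$ is transmitted and the active AF path changes every $T$ symbol times, so that the end-to-end channel is a parallel channel $\{\boldsymbol\Pi_k\}_{k=1}^K$ in the time domain. DMT of the time-domain parallel channel $\{\boldsymbol\Pi_k\}_{k=1}^K$: $d(r)=-\lim_{\mathsf{SNR}\to\infty}\log\mathsf P\{\sum_{k=1}^K\log\det(\mathbf I+\mathsf{SNR}\,\boldsymbol\Pi_k\boldsymbol\Pi_k^\dagger)<KR\}/\log\mathsf{SNR}$, with $R=r\log\mathsf{SNR}$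 for $r>0$ and $R>0$ fixed for $r=0$. *)

theory Defs
  imports
    "HOL-Probability.Probability"
    "Jordan_Normal_Form.Determinant"
    "Jordan_Normal_Form.Schur_Decomposition"
    "Jordan_Normal_Form.DL_Submatrix"
begin

text \<open>Density of \<open>CN(0,1)\<close>: circularly symmetric, total variance 1 (1/2 per real dimension).\<close>

definition cn_density :: "complex \<Rightarrow> real" where
  "cn_density z = exp (- (cmod z)\<^sup>2) / pi"

text \<open>
  Antenna nodes of layer \<open>i\<close> are \<open>0, \<dots>, n i - 1\<close>; \<open>H i\<close> (for \<open>i \<ge> 1\<close>) is the random channel
  matrix from layer \<open>i - 1\<close> to layer \<open>i\<close>.  Mutual independence of the matrices together with
  independence of the entries within each matrix is expressed as joint independence of all entries.
\<close>

definition multihop_channel ::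
  "nat \<Rightarrow> (nat \<Rightarrow> nat) \<Rightarrow> 'w measure \<Rightarrow> (nat \<Rightarrow> 'w \<Rightarrow> complex mat) \<Rightarrow> bool" where
  "multihop_channel N n M H \<longleftrightarrow>
     prob_space M \<and>
     (\<forall>i\<in>{1..N}. \<forall>\<omega>\<in>space M. H i \<omega> \<in> carrier_mat (n i) (n (i - 1))) \<and>
     (\<forall>i\<in>{1..N}. \<forall>a<n i. \<forall>b<n (i - 1).
        distributed M lborel (\<lambda>\<omega>. H i \<omega> $$ (a, b)) (\<lambda>z. ennreal (cn_density z))) \<and>
     prob_space.indep_vars M (\<lambda>_. borel) (\<lambda>(i, a, b) \<omega>. H i \<omega> $$ (a, b))
       (SIGMA i:{1..N}. {..<n i} \<times> {..<n (i - 1)})"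

definition supernode_partition :: "nat \<Rightarrow> (nat \<Rightarrow> nat) \<Rightarrow> (nat \<Rightarrow> nat set set) \<Rightarrow> bool" where
  "supernode_partition N n S \<longleftrightarrow> (\<forall>i\<le>N. partition_on {..<n i} (S i))"

text \<open>
  Paths are extensional functions, so that distinct elements of \<open>AF_paths N S\<close> are distinct
  sequences of supernodes.
\<close>

definition AF_paths :: "nat \<Rightarrow> (nat \<Rightarrow> nat set set) \<Rightarrow> (nat \<Rightarrow> nat set) set" where
  "AF_paths N S = (\<Pi>\<^sub>E i\<in>{..N}. S i)"

text \<open>
  The edge \<open>(i, a, b)\<close> is the channel from node \<open>b\<close> of layer \<open>i - 1\<close> to node \<open>a\<close> of layer \<open>i\<close>.
\<close>

definition path_edges :: "nat \<Rightarrow> (nat \<Rightarrow> nat set) \<Rightarrow> (nat \<times> nat \<times> nat) set" where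
  "path_edges N P = (SIGMA i:{1..N}. P i \<times> P (i - 1))"

definition parallel_partition ::
  "nat \<Rightarrow> (nat \<Rightarrow> nat) \<Rightarrow> (nat \<Rightarrow> nat set set) \<Rightarrow> (nat \<Rightarrow> nat set) set \<Rightarrow> bool" where
  "parallel_partition N n S \<P> \<longleftrightarrow>
     supernode_partition N n S \<and> \<P> \<noteq> {} \<and> \<P> \<subseteq> AF_paths N S"

definition independent_paths :: "nat \<Rightarrow> (nat \<Rightarrow> nat set) set \<Rightarrow> bool" where
  "independent_paths N \<P> \<longleftrightarrow> pairwise (\<lambda>P Q. path_edges N P \<inter> path_edges N Q = {}) \<P>"

text \<open>
  End-to-end channel of an AF path up to layer \<open>i\<close>: the product of the sub-matrices of
  \<open>H i, \<dots>, H 1\<close>.  Power-normalization factors do not affect the DMT and are left out.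
\<close>

primrec path_channel :: "(nat \<Rightarrow> complex mat) \<Rightarrow> (nat \<Rightarrow> nat set) \<Rightarrow> nat \<Rightarrow> complex mat" where
  "path_channel H P 0 = 1\<^sub>m (card (P 0))"
| "path_channel H P (Suc i) =
     submatrix (H (Suc i)) (P (Suc i)) (P i) * path_channel H P i"

text \<open>
  The determinant below is real (and at least 1, for \<open>snr \<ge> 0\<close>), so \<open>Re\<close> loses nothing.
\<close>

definition log_det :: "real \<Rightarrow> complex mat \<Rightarrow> real" where
  "log_det snr G =
     ln (Re (Determinant.det (1\<^sub>m (dim_row G) + complex_of_real snr \<cdot>\<^sub>m (G * mat_adjoint G))))"

text \<open>
  Outage probability of the time-domain parallel channel \<open>G k\<close>, \<open>k \<in> I\<close>, at rate \<open>R\<close>.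
\<close>

definition outage_prob ::
  "'w measure \<Rightarrow> 'k set \<Rightarrow> ('k \<Rightarrow> 'w \<Rightarrow> complex mat) \<Rightarrow> real \<Rightarrow> real \<Rightarrow> real" where
  "outage_prob M I G snr R =
     measure M {\<omega> \<in> space M. (\<Sum>k\<in>I. log_det snr (G k \<omega>)) < real (card I) * R}"

text \<open>
  \<open>outage_exponent p d\<close>: the outage probability \<open>p snr\<close> decays like \<open>snr powr - d\<close>.
  Since \<open>ln 0 = 0\<close>, positivity of the probability is required explicitly; otherwise a
  vanishing probability (infinite exponent) would be read as exponent 0.
\<close>

definition outage_exponent :: "(real \<Rightarrow> real) \<Rightarrow> real \<Rightarrow> bool" where
  "outage_exponent p d \<longleftrightarrow>
     eventually (\<lambda>snr. p snr > 0) at_top \<and>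
     ((\<lambda>snr. - (ln (p snr) / ln snr)) \<longlongrightarrow> d) at_top"

text \<open>
  \<open>has_dmt M I G d\<close>: the channel has diversity \<open>d r\<close> at every multiplexing gain \<open>r \<ge> 0\<close>, where
  \<open>R = r log SNR\<close> for \<open>r > 0\<close>, and \<open>R > 0\<close> is an arbitrary constant for \<open>r = 0\<close>.
\<close>

definition has_dmt ::
  "'w measure \<Rightarrow> 'k set \<Rightarrow> ('k \<Rightarrow> 'w \<Rightarrow> complex mat) \<Rightarrow> (real \<Rightarrow> real) \<Rightarrow> bool" where
  "has_dmt M I G d \<longleftrightarrow>
     (\<forall>r>0. outage_exponent (\<lambda>snr. outage_prob M I G snr (r * ln snr)) (d r)) \<and>
     (\<forall>R>0. outage_exponent (\<lambda>snr. outage_prob M I G snr R) (d 0))"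

end

theory Submission
  imports Defs
begin

text \<open>
  Take single antennas as supernodes. Dealing the paths out evenly among the nodes of each layer
  yields \<open>K = d\<^sub>m\<^sub>a\<^sub>x\<close> edge-disjoint paths, and the channel of each is a product of \<open>N\<close> scalars \<open>h\<^sub>e\<close>,
  all of them independent.

  In outage, \<open>(\<Prod>\<^sub>k SNR * \<Prod>\<^sub>e |h\<^sub>e|\<^sup>2) < exp (K * R)\<close>, so the product of all \<open>|h\<^sub>e|\<^sup>2\<close> is less than
  \<open>exp (K * R) / SNR ^ K\<close>. Since \<open>|h\<^sub>e|\<^sup>2\<close> has finite moments of order \<open>- s\<close> for every \<open>s < 1\<close>,
  Markov's inequality bounds the outage probability by a constant times
  \<open>SNR powr (- s * K * (1 - r))\<close>; let \<open>s\<close> tend to 1. Conversely, outage occurs when the first edge of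
  every path satisfies \<open>|h\<^sub>e|\<^sup>2 < (exp R - 1) / SNR\<close> and all other edges satisfy \<open>|h\<^sub>e|\<^sup>2 < 1\<close>, an event
  whose probability has exponent \<open>K * (1 - r)\<^sup>+\<close>.
\<close>

section \<open>Edge-disjoint paths\<close>

text \<open>The inductive step of the path construction: \<open>p\<close> and \<open>q\<close> place
  the paths in two adjacent layers, and injectivity of the pair means that no edge between them is
  used twice. In the balance clause \<open>l\<close> will be the size of the layer that
  follows.\<close>

lemma ex_balanced_refinement:
  fixes p :: "nat \<Rightarrow> nat" and K m :: nat
  assumes "m > 0" and fibre: "\<And>v. card {k. k < K \<and> p k = v} \<le> m"
  shows "\<exists>q. (\<forall>k<K. q k < m) \<and> inj_on (\<lambda>k. (p k, q k)) {..<K} \<and>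
    (\<forall>v l. K \<le> m * l \<longrightarrow> card {k. k < K \<and> q k = v} \<le> l)"
proof -
  \<comment> \<open>Number the \<open>k < K\<close> consecutively so that each fibre of \<open>p\<close> occupies an interval of length at
    most \<open>m\<close>, then deal them out cyclically modulo \<open>m\<close>.\<close>
  define B where "B k = {l. l < K \<and> (p l < p k \<or> p l = p k \<and> l < k)}" for k
  define s where "s k = card (B k)" for k
  have finB: "finite (B k)" for k by (auto simp: B_def)
  have s_less: "s k < K" if "k < K" for k
  proof -
    have "B k \<subset> {..<K}" using that by (auto simp: B_def)
    then have "card (B k) < card {..<K}" by (intro psubset_card_mono) simp_all
    then show ?thesis by (simp add: s_def)
  qed
  have s_mono: "s k < s k'" if "k < K" "p k < p k' \<or> p k = p k' \<and> k < k'" for k k'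
    unfolding s_def using that by (intro psubset_card_mono finB) (auto simp: B_def)
  have s_inj: "inj_on s {..<K}"
  proof (rule inj_onI)
    fix k k' assume "k \<in> {..<K}" "k' \<in> {..<K}" "s k = s k'"
    then show "k = k'" using s_mono[of k k'] s_mono[of k' k] by force
  qed
  have s_fibre: "s k' < s k + m" if "k < k'" "k' < K" "p k = p k'" for k k'
  proof -
    define F where "F = {l. l < K \<and> p l = p k}"
    \<comment> \<open>In the numbering only elements of the common fibre come between
      \<open>k\<close> and \<open>k'\<close>, and \<open>k'\<close> itself is not counted, which
      makes the bound strict.\<close>
    have "B k' \<subseteq> B k \<union> (F - {k'})" using that by (auto simp: B_def F_def)
    then have "s k' \<le> card (B k \<union> (F - {k'}))"
      unfolding s_def by (intro card_mono) (auto simp: B_def F_def)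
    also have "\<dots> \<le> s k + card (F - {k'})" unfolding s_def by (rule card_Un_le)
    also have "card (F - {k'}) < card F"
      using that by (intro card_Diff1_less) (auto simp: F_def)
    also have "card F \<le> m" unfolding F_def by (rule fibre)
    finally show ?thesis by simp
  qed
  have ne: "s k mod m \<noteq> s k' mod m" if "k < k'" "k' < K" "p k = p k'" for k k'
  proof
    assume *: "s k mod m = s k' mod m"
    have lt: "s k < s k'" using s_mono that by auto
    then have "m dvd s k' - s k" using * by (metis mod_eq_dvd_iff_nat less_imp_le)
    moreover have "0 < s k' - s k" "s k' - s k < m" using lt s_fibre[OF that] by auto
    ultimately show False by (auto dest: nat_dvd_not_less)
  qed
  have "card {k. k < K \<and> s k mod m = v} \<le> l" if "K \<le> m * l" for v l
  proof -
    have "card {k. k < K \<and> s k mod m = v} \<le> card {..<l}"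
    \<comment> \<open>On a residue class \<open>s k div m\<close> determines \<open>s k\<close>,
      hence \<open>k\<close>, and \<open>s k < K \<le> m * l\<close> keeps the quotient below
      \<open>l\<close>.\<close>
    proof (rule card_inj_on_le[where f = "\<lambda>k. s k div m"])
      show "inj_on (\<lambda>k. s k div m) {k. k < K \<and> s k mod m = v}"
      proof (rule inj_onI)
        fix k k' assume *: "k \<in> {k. k < K \<and> s k mod m = v}" "k' \<in> {k. k < K \<and> s k mod m = v}"
          "s k div m = s k' div m"
        then have "s k = s k'" by (metis (mono_tags, lifting) mem_Collect_eq div_mult_mod_eq)
        then show "k = k'" using * s_inj by (auto dest: inj_onD)
      qed
      show "(\<lambda>k. s k div m) ` {k. k < K \<and> s k mod m = v} \<subseteq> {..<l}"
      proof clarsimp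
        fix k assume "k < K"
        then have "s k < l * m" using s_less that by (metis less_le_trans mult.commute)
        then show "s k div m < l" by (rule less_mult_imp_div_less)
      qed
    qed simp
    then show ?thesis by simp
  qed
  moreover have "inj_on (\<lambda>k. (p k, s k mod m)) {..<K}"
  proof (rule inj_onI)
    fix k k' assume "k \<in> {..<K}" "k' \<in> {..<K}" "(p k, s k mod m) = (p k', s k' mod m)"
    then show "k = k'" using ne[of k k'] ne[of k' k] by force
  qed
  ultimately show ?thesis
    using \<open>m > 0\<close> by (intro exI[where x = "\<lambda>k. s k mod m"]) auto
qed

text \<open>
  A balanced assignment of \<open>K \<le> n i * n (Suc i)\<close> paths to the nodes of layer \<open>i\<close> has fibres of size at
  most \<open>n (Suc i)\<close>, which is what the extension to the next layer needs.
\<close>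

lemma ex_edge_disjoint_node_paths:
  assumes pos: "\<And>i. i \<le> N \<Longrightarrow> n i > 0"
    and K: "\<And>i. i < N \<Longrightarrow> K \<le> n i * n (Suc i)"
  shows "\<exists>c :: nat \<Rightarrow> nat \<Rightarrow> nat. (\<forall>i\<le>N. \<forall>k<K. c i k < n i) \<and>
    (\<forall>i<N. inj_on (\<lambda>k. (c i k, c (Suc i) k)) {..<K})"
proof -
  have "\<exists>c :: nat \<Rightarrow> nat \<Rightarrow> nat. (\<forall>i\<le>N. \<forall>k<K. c i k < n i) \<and>
    (\<forall>i<N. inj_on (\<lambda>k. (c i k, c (Suc i) k)) {..<K}) \<and>
    (\<forall>v l. K \<le> n N * l \<longrightarrow> card {k. k < K \<and> c N k = v} \<le> l)"
    using assms
  proof (induction N)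
    case 0
    \<comment> \<open>Layer 0 has no predecessor. The identity, whose fibres have at most one
      element, stands in for it.\<close>
    have "card {k. k < K \<and> k = v} \<le> n 0" for v
    proof -
      have "card {k. k < K \<and> k = v} \<le> card {v}" by (intro card_mono) auto
      then show ?thesis using "0.prems"(1)[of 0] by simp
    qed
    from ex_balanced_refinement[of "n 0" K "\<lambda>k. k", OF _ this] "0.prems"(1)[of 0]
    obtain q where "\<forall>k<K. q k < n 0" "\<forall>v l. K \<le> n 0 * l \<longrightarrow> card {k. k < K \<and> q k = v} \<le> l"
      by auto
    then show ?case by (intro exI[where x = "\<lambda>_. q"]) auto
  next
    case (Suc N)
    then obtain c where c: "\<forall>i\<le>N. \<forall>k<K. c i k < n i"
      "\<forall>i<N. inj_on (\<lambda>k. (c i k, c (Suc i) k :: nat)) {..<K}"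
      "\<forall>v l. K \<le> n N * l \<longrightarrow> card {k. k < K \<and> c N k = v} \<le> l" by force
    have "card {k. k < K \<and> c N k = v} \<le> n (Suc N)" for v
      using c(3) Suc.prems(2)[of N] by auto
    from ex_balanced_refinement[of "n (Suc N)" K "c N", OF _ this] Suc.prems(1)[of "Suc N"]
    obtain q where q: "\<forall>k<K. q k < n (Suc N)" "inj_on (\<lambda>k. (c N k, q k)) {..<K}"
      "\<forall>v l. K \<le> n (Suc N) * l \<longrightarrow> card {k. k < K \<and> q k = v} \<le> l"
      by auto
    show ?case
      using c q by (intro exI[where x = "c(Suc N := q)"]) (auto simp: le_Suc_eq less_Suc_eq)
  qed
  then show ?thesis by blast
qed

section \<open>Scalar path channels\<close>

lemma submatrix_singleton:
  assumes "A \<in> carrier_mat nr nc" "a < nr" "b < nc"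
  shows "submatrix A {a} {b} \<in> carrier_mat 1 1" "submatrix A {a} {b} $$ (0, 0) = A $$ (a, b)"
proof -
  have rows: "{i. i < dim_row A \<and> i \<in> {a}} = {a}"
    and cols: "{j. j < dim_col A \<and> j \<in> {b}} = {b}"
    using assms by auto
  show "submatrix A {a} {b} \<in> carrier_mat 1 1"
    by (rule carrier_matI) (simp_all only: dim_submatrix rows cols card_1_singleton_iff, simp_all)
  \<comment> \<open>Submatrix indices are translated by \<open>pick\<close>, whose value at 0 is the
    least element of the index set.\<close>
  have "(LEAST i. i = k) = k" for k :: nat by (rule Least_equality) simp_all
  then show "submatrix A {a} {b} $$ (0, 0) = A $$ (a, b)"
    using submatrix_index[of 0 A "{a}" 0 "{b}"] unfolding rows cols by simp
qed

text \<open>Every factor is a 1 by 1 matrix, so the matrix product is a multiplication of scalars,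
  one per hop.\<close>

lemma path_channel_singletons:
  assumes "\<And>i. i \<le> N \<Longrightarrow> P i = {c i}" "\<And>i. i \<le> N \<Longrightarrow> c i < n i"
    and "\<And>i. i \<in> {1..N} \<Longrightarrow> H i \<in> carrier_mat (n i) (n (i - 1))"
  shows "path_channel H P N \<in> carrier_mat 1 1 \<and>
    path_channel H P N $$ (0, 0) = (\<Prod>i=1..N. H i $$ (c i, c (i - 1)))"
  using assms
proof (induction N)
  case 0
  then show ?case by simp
next
  case (Suc N)
  let ?S = "submatrix (H (Suc N)) {c (Suc N)} {c N}"
  have S: "?S \<in> carrier_mat 1 1" "?S $$ (0, 0) = H (Suc N) $$ (c (Suc N), c N)"
    using submatrix_singleton[of "H (Suc N)" "n (Suc N)" "n N" "c (Suc N)" "c N"]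
      Suc.prems(2)[of "Suc N"] Suc.prems(2)[of N] Suc.prems(3)[of "Suc N"] by auto
  have IH: "path_channel H P N \<in> carrier_mat 1 1"
    "path_channel H P N $$ (0, 0) = (\<Prod>i=1..N. H i $$ (c i, c (i - 1)))"
    using Suc by auto
  have "path_channel H P (Suc N) = ?S * path_channel H P N"
    using Suc.prems(1) by simp
  moreover have "(?S * path_channel H P N) $$ (0, 0) = ?S $$ (0, 0) * path_channel H P N $$ (0, 0)"
    using S(1) IH(1) by (simp add: scalar_prod_def)
  ultimately show ?case
    using S IH by (simp add: mult.commute)
qed

lemma log_det_scalar:
  assumes "G \<in> carrier_mat 1 1"
  shows "log_det snr G = ln (1 + snr * (cmod (G $$ (0, 0)))\<^sup>2)"
proof -
  have dims: "dim_row G = 1" "dim_col G = 1" using assms by auto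
  have adj: "mat_adjoint G \<in> carrier_mat 1 1"
    by (rule carrier_matI) (simp_all add: mat_adjoint_def dims)
  have "mat_adjoint G $$ (0, 0) = cnj (G $$ (0, 0))"
    by (simp add: mat_adjoint_def mat_of_rows_def cols_def dims)
  then have "(G * mat_adjoint G) $$ (0, 0) = G $$ (0, 0) * cnj (G $$ (0, 0))"
    using assms adj by (simp add: scalar_prod_def)
  also have "\<dots> = complex_of_real ((cmod (G $$ (0, 0)))\<^sup>2)"
    by (simp only: complex_norm_square)
  finally have "Determinant.det (1\<^sub>m (dim_row G) + complex_of_real snr \<cdot>\<^sub>m (G * mat_adjoint G))
      = 1 + complex_of_real snr * complex_of_real ((cmod (G $$ (0, 0)))\<^sup>2)"
    using assms adj by (subst det_single) auto
  then show ?thesis unfolding log_det_def by simp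
qed

section \<open>Small values of Gaussian products\<close>

lemma (in prob_space) indep_sets_reindex:
  assumes inj: "inj_on f I" and ind: "indep_sets F (f ` I)"
  shows "indep_sets (\<lambda>i. F (f i)) I"
  unfolding indep_sets_def
proof (intro conjI ballI allI impI)
  show "F (f i) \<subseteq> events" if "i \<in> I" for i
    using ind that unfolding indep_sets_def by blast
next
  fix J A assume J: "J \<subseteq> I" "J \<noteq> {}" "finite J" and A: "A \<in> (\<Pi> i\<in>J. F (f i))"
  define B where "B = (\<lambda>j. A (the_inv_into I f j))"
  have B: "B (f i) = A i" if "i \<in> J" for i
    using that J(1) inj by (auto simp: B_def the_inv_into_f_f)
  have "prob (\<Inter>j\<in>f ` J. B j) = (\<Prod>j\<in>f ` J. prob (B j))"
    by (rule indep_setsD[OF ind]) (use J A B in auto)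
  moreover have "inj_on f J" using inj J(1) by (rule inj_on_subset)
  ultimately show "prob (\<Inter>i\<in>J. A i) = (\<Prod>i\<in>J. prob (A i))"
    using B by (simp add: prod.reindex cong: INF_cong prod.cong)
qed

text \<open>Serves to pass from channel entries indexed by edges to gains indexed by path and
  hop.\<close>

lemma (in prob_space) indep_vars_reindex:
  assumes "inj_on f I" and "indep_vars M' X (f ` I)"
  shows "indep_vars (\<lambda>i. M' (f i)) (\<lambda>i. X (f i)) I"
  using assms indep_sets_reindex[of f I] unfolding indep_vars_def2 by auto

section \<open>Small-ball estimates and negative moments\<close>

lemma cn_density_measurable [measurable]: "cn_density \<in> borel_measurable borel"
  unfolding cn_density_def by measurable

text \<open>The density is at most \<open>1 / pi\<close>, and the disc of radius
  \<open>sqrt t\<close> has area \<open>pi * t\<close>.\<close>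

lemma (in prob_space) prob_cn_le:
  assumes D: "distributed M lborel X (\<lambda>z. ennreal (cn_density z))" and "t > 0"
  shows "prob {\<omega> \<in> space M. (cmod (X \<omega>))\<^sup>2 \<le> t} \<le> t"
proof -
  have eq: "{\<omega> \<in> space M. (cmod (X \<omega>))\<^sup>2 \<le> t} = X -` cball 0 (sqrt t) \<inter> space M"
    using \<open>t > 0\<close> by (auto simp: real_le_rsqrt sqrt_ge_absD)
  have "emeasure M (X -` cball 0 (sqrt t) \<inter> space M)
      = (\<integral>\<^sup>+z. ennreal (cn_density z) * indicator (cball 0 (sqrt t)) z \<partial>lborel)"
    by (rule distributed_emeasure[OF D]) simp
  also have "\<dots> \<le> (\<integral>\<^sup>+z. ennreal (1 / pi) * indicator (cball 0 (sqrt t)) (z :: complex) \<partial>lborel)"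
    by (intro nn_integral_mono)
       (auto simp: cn_density_def divide_right_mono indicator_def intro!: ennreal_leI)
  also have "\<dots> = ennreal (1 / pi) * ennreal (pi * t)"
    using \<open>t > 0\<close>
    by (simp add: nn_integral_cmult_indicator emeasure_cball unit_ball_vol_2 power2_eq_square)
  also have "\<dots> = ennreal t"
    using \<open>t > 0\<close> by (simp flip: ennreal_mult)
  finally show ?thesis
    unfolding eq using \<open>t > 0\<close> by (simp add: emeasure_eq_measure)
qed

text \<open>Since \<open>t \<le> 1\<close>, the density is at least \<open>exp (- 1) / pi\<close> on
  the disc of radius \<open>sqrt t\<close>.\<close>

lemma (in prob_space) prob_cn_ge:
  assumes D: "distributed M lborel X (\<lambda>z. ennreal (cn_density z))" and t: "0 < t" "t \<le> 1"
  shows "exp (- 1) * t \<le> prob {\<omega> \<in> space M. (cmod (X \<omega>))\<^sup>2 < t}"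
proof -
  have eq: "{\<omega> \<in> space M. (cmod (X \<omega>))\<^sup>2 < t} = X -` ball 0 (sqrt t) \<inter> space M"
    using \<open>t > 0\<close> by (auto simp: real_less_rsqrt) (metis norm_ge_zero not_le real_le_lsqrt real_sqrt_less_iff real_sqrt_unique)
  have "ennreal (exp (- 1) * t) = ennreal (exp (- 1) / pi) * ennreal (pi * t)"
    using t by (simp flip: ennreal_mult)
  also have "\<dots> = (\<integral>\<^sup>+z. ennreal (exp (- 1) / pi) * indicator (ball 0 (sqrt t)) (z :: complex) \<partial>lborel)"
    using t
    by (simp add: nn_integral_cmult_indicator emeasure_ball unit_ball_vol_2 power2_eq_square)
  also have "\<dots> \<le> (\<integral>\<^sup>+z. ennreal (cn_density z) * indicator (ball 0 (sqrt t)) z \<partial>lborel)"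
  proof (intro nn_integral_mono)
    fix z :: complex
    have "exp (- 1) / pi \<le> cn_density z" if "z \<in> ball 0 (sqrt t)"
    proof -
      have "(cmod z)\<^sup>2 \<le> (sqrt t)\<^sup>2" using that by (intro power_mono) auto
      then show ?thesis using t by (simp add: cn_density_def divide_right_mono)
    qed
    then show "ennreal (exp (- 1) / pi) * indicator (ball 0 (sqrt t)) z
        \<le> ennreal (cn_density z) * indicator (ball 0 (sqrt t)) z"
      by (auto simp: indicator_def intro!: ennreal_leI)
  qed
  also have "\<dots> = emeasure M (X -` ball 0 (sqrt t) \<inter> space M)"
    by (rule distributed_emeasure[OF D, symmetric]) simp
  finally show ?thesis
    unfolding eq by (simp add: emeasure_eq_measure)
qed

lemma (in prob_space) nn_integral_powr_neg_finite:
  assumes Y [measurable]: "Y \<in> borel_measurable M"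
    and small: "\<And>t. t > 0 \<Longrightarrow> prob {\<omega> \<in> space M. Y \<omega> \<le> t} \<le> t"
    and nonneg: "\<And>\<omega>. Y \<omega> \<ge> 0" and s: "0 < s" "s < 1"
  shows "(\<integral>\<^sup>+\<omega>. ennreal (Y \<omega> powr - s) \<partial>M) < \<infinity>"
proof -
  \<comment> \<open>dyadic decomposition of small values of \<open>Y\<close>: the resulting series is geometric with ratio
    \<open>2 powr (s - 1)\<close>\<close>
  define A where "A j = {\<omega> \<in> space M. Y \<omega> \<le> 2 powr - real j}" for j :: nat
  have A [measurable]: "A j \<in> sets M" for j unfolding A_def by measurable
  \<comment> \<open>The value of \<open>y powr - s\<close> at \<open>y = 2 powr - (j + 1)\<close>,
    the lower end of the dyadic shell number \<open>j\<close>; it bounds \<open>y powr - s\<close>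
    on that shell.\<close>
  define g where "g j = 2 powr (s * (real j + 1))" for j :: nat
  have bound: "ennreal (Y \<omega> powr - s) \<le> 1 + (\<Sum>j. ennreal (g j) * indicator (A j) \<omega>)"
    if "\<omega> \<in> space M" for \<omega>
  proof -
    define y where "y = Y \<omega>"
    consider "y = 0" | "y > 1" | "0 < y" "y \<le> 1" using nonneg[of \<omega>] y_def by linarith
    then show ?thesis
    proof cases
      \<comment> \<open>\<open>0 powr - s\<close> is 0, not infinity, so the bound is trivial
        here.\<close>
      case 1
      then show ?thesis by (simp add: y_def)
    next
      case 2
      then have "y powr - s \<le> 1 powr - s" using s by (intro powr_mono2') auto
      then have "ennreal (Y \<omega> powr - s) \<le> 1" by (simp add: y_def ennreal_le_1)
      then show ?thesis by (rule order_trans) simp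
    next
      case 3
      define j where "j = nat \<lfloor>- log 2 y\<rfloor>"
      have "- log 2 y \<ge> 0" using 3 by simp
      then have j: "real j \<le> - log 2 y" "- log 2 y \<le> real j + 1" unfolding j_def by linarith+
      have y: "y = 2 powr (log 2 y)" using 3 by simp
      have "2 powr log 2 y \<le> (2 :: real) powr - real j" using j by (intro powr_mono) auto
      then have "y \<le> 2 powr - real j" using y by (rule ord_eq_le_trans[rotated])
      then have in_A: "\<omega> \<in> A j" using that by (simp add: A_def y_def)
      have "y powr - s = 2 powr (s * - log 2 y)" by (subst y) (simp only: powr_powr, simp add: mult.commute)
      also have "\<dots> \<le> g j" unfolding g_def using j s by (intro powr_mono mult_left_mono) auto
      finally have "ennreal (Y \<omega> powr - s) \<le> ennreal (g j) * indicator (A j) \<omega>"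
        using in_A by (simp add: y_def ennreal_leI)
      also have "\<dots> = (\<Sum>i\<in>{j}. ennreal (g i) * indicator (A i) \<omega>)"
        by (simp only: sum.insert[OF finite.emptyI] sum.empty empty_iff not_False_eq_True add_0_right)
      also have "\<dots> \<le> (\<Sum>i. ennreal (g i) * indicator (A i) \<omega>)" by (intro sum_le_suminf) auto
      also have "\<dots> \<le> 1 + \<dots>" by simp
      finally show ?thesis .
    qed
  qed
  have "(\<integral>\<^sup>+\<omega>. ennreal (Y \<omega> powr - s) \<partial>M)
      \<le> (\<integral>\<^sup>+\<omega>. 1 + (\<Sum>j. ennreal (g j) * indicator (A j) \<omega>) \<partial>M)"
    by (intro nn_integral_mono bound)
  also have "\<dots> = 1 + (\<Sum>j. ennreal (g j) * emeasure M (A j))"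
    by (simp add: nn_integral_add nn_integral_suminf nn_integral_cmult_indicator emeasure_space_1)
  also have "\<dots> \<le> 1 + (\<Sum>j. ennreal (2 powr s * (2 powr (s - 1)) ^ j))"
  proof (intro add_left_mono suminf_le)
    fix j
    have "ennreal (g j) * emeasure M (A j) \<le> ennreal (g j) * ennreal (2 powr - real j)"
      unfolding A_def emeasure_eq_measure by (intro mult_left_mono ennreal_leI small) auto
    also have "\<dots> = ennreal (2 powr (s * (real j + 1) - real j))"
      by (simp add: g_def powr_diff powr_minus divide_inverse flip: ennreal_mult)
    also have "2 powr (s * (real j + 1) - real j) = 2 powr s * (2 powr (s - 1)) ^ j"
      by (simp add: powr_realpow[symmetric] powr_powr powr_add[symmetric] algebra_simps)
    finally show "ennreal (g j) * emeasure M (A j) \<le> ennreal (2 powr s * (2 powr (s - 1)) ^ j)" .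
  qed auto
  also have "\<dots> < \<infinity>"
  proof -
    have "2 powr (s - 1) < (2 :: real) powr 0" using s by (intro powr_less_mono) auto
    then have "summable (\<lambda>j. 2 powr s * (2 powr (s - 1)) ^ j :: real)"
      by (intro summable_mult summable_geometric) auto
    then have "(\<Sum>j. ennreal (2 powr s * (2 powr (s - 1)) ^ j)) = ennreal (\<Sum>j. 2 powr s * (2 powr (s - 1)) ^ j)"
      by (intro suminf_ennreal2) auto
    then show ?thesis by simp
  qed
  finally show ?thesis .
qed

text \<open>Independence splits the moment of order \<open>- s\<close> of the product into finite
  factors. Markov's inequality then costs only a constant \<open>C\<close>, which may depend on
  \<open>s\<close> but not on \<open>t\<close>.\<close>

lemma (in prob_space) prob_prod_cn_le:
  assumes I: "finite I" and ind: "indep_vars (\<lambda>_. borel) X I"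
    and D: "\<And>i. i \<in> I \<Longrightarrow> distributed M lborel (X i) (\<lambda>z. ennreal (cn_density z))"
    and s: "0 < s" "s < 1"
  shows "\<exists>C>0. \<forall>t>0. prob {\<omega> \<in> space M. (\<Prod>i\<in>I. (cmod (X i \<omega>))\<^sup>2) \<le> t} \<le> C * t powr s"
proof -
  have rv [measurable]: "X i \<in> borel_measurable M" if "i \<in> I" for i
    using ind that by (auto simp: indep_vars_def)
  define f where "f i \<omega> = ennreal (((cmod (X i \<omega>))\<^sup>2) powr - s)" for i \<omega>
  have "(\<integral>\<^sup>+\<omega>. f i \<omega> \<partial>M) < \<infinity>" if "i \<in> I" for i
    unfolding f_def using rv[OF that]
    by (intro nn_integral_powr_neg_finite prob_cn_le[OF D[OF that]] s) auto
  then have fin: "(\<Prod>i\<in>I. \<integral>\<^sup>+\<omega>. f i \<omega> \<partial>M) < \<infinity>"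
    using I by (simp add: ennreal_prod_eq_top less_top[symmetric])
  then obtain c where c: "c \<ge> 0" "(\<Prod>i\<in>I. \<integral>\<^sup>+\<omega>. f i \<omega> \<partial>M) = ennreal c"
    by (auto simp: less_top_ennreal)
  have "indep_vars (\<lambda>_. borel) (\<lambda>i \<omega>. ennreal (((cmod (X i \<omega>))\<^sup>2) powr - s)) I"
    by (rule indep_vars_compose2[OF ind, where Y = "\<lambda>_ z. ennreal (((cmod z)\<^sup>2) powr - s)"]) measurable
  then have "indep_vars (\<lambda>_. borel) f I" by (simp add: f_def[abs_def])
  then have int: "(\<integral>\<^sup>+\<omega>. (\<Prod>i\<in>I. f i \<omega>) \<partial>M) = ennreal c"
    using I c by (subst indep_vars_nn_integral) auto
  \<comment> \<open>the null set where \<open>0 powr - s = 0\<close> would spoil Markov's inequality\<close>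
  have nz: "AE \<omega> in M. X i \<omega> \<noteq> 0" if "i \<in> I" for i
  proof -
    have [measurable]: "X i \<in> borel_measurable M" using that by simp
    define Z where "Z = {\<omega> \<in> space M. X i \<omega> = 0}"
    have Z: "Z \<in> sets M" unfolding Z_def by measurable
    have "prob Z \<le> t" if "t > 0" for t
    proof -
      have "prob Z \<le> prob {\<omega> \<in> space M. (cmod (X i \<omega>))\<^sup>2 \<le> t}"
        using that by (intro finite_measure_mono) (auto simp: Z_def)
      also have "\<dots> \<le> t" using prob_cn_le[OF D[OF \<open>i \<in> I\<close>] that] .
      finally show ?thesis .
    qed
    then have "prob Z \<le> 0" by (rule field_le_epsilon[of "prob Z" 0, simplified])
    then have "prob Z = 0" by (simp add: measure_le_0_iff)
    then have "AE \<omega> in M. \<omega> \<notin> Z" using Z by (simp add: AE_iff_null_sets[symmetric] null_sets_def emeasure_eq_measure)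
    then show ?thesis by (auto simp: Z_def elim!: AE_mp)
  qed
  \<comment> \<open>Only \<open>c \<ge> 0\<close> is known, while the constant has to be positive;
    hence \<open>c + 1\<close>.\<close>
  have "prob {\<omega> \<in> space M. (\<Prod>i\<in>I. (cmod (X i \<omega>))\<^sup>2) \<le> t} \<le> (c + 1) * t powr s" if "t > 0" for t
  proof -
    let ?A = "{\<omega> \<in> space M. (\<Prod>i\<in>I. (cmod (X i \<omega>))\<^sup>2) \<le> t}"
    have A: "?A \<in> sets M" by measurable
    have "ennreal (prob ?A) = (\<integral>\<^sup>+\<omega>. indicator ?A \<omega> \<partial>M)"
      using A by (simp add: emeasure_eq_measure)
    also have "\<dots> \<le> (\<integral>\<^sup>+\<omega>. ennreal (t powr s) * (\<Prod>i\<in>I. f i \<omega>) \<partial>M)"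
    proof (rule nn_integral_mono_AE)
      have "AE \<omega> in M. \<forall>i\<in>I. X i \<omega> \<noteq> 0" using nz I by (simp add: AE_finite_all)
      then show "AE \<omega> in M. indicator ?A \<omega> \<le> ennreal (t powr s) * (\<Prod>i\<in>I. f i \<omega>)"
      proof (rule AE_mp, intro AE_I2 impI)
        fix \<omega> assume nz: "\<forall>i\<in>I. X i \<omega> \<noteq> 0"
        define x where "x = (\<Prod>i\<in>I. (cmod (X i \<omega>))\<^sup>2)"
        have "x > 0" unfolding x_def using nz by (intro prod_pos) auto
        have "(\<Prod>i\<in>I. f i \<omega>) = ennreal (\<Prod>i\<in>I. ((cmod (X i \<omega>))\<^sup>2) powr - s)"
          unfolding f_def by (rule prod_ennreal) simp
        also have "(\<Prod>i\<in>I. ((cmod (X i \<omega>))\<^sup>2) powr - s) = x powr - s"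
          unfolding x_def by (rule prod_powr_distrib[symmetric])
        finally have "ennreal (t powr s) * (\<Prod>i\<in>I. f i \<omega>) = ennreal (t powr s * x powr - s)"
          by (simp add: ennreal_mult)
        moreover have "1 \<le> t powr s * x powr - s" if "x \<le> t"
          using powr_mono2[of s x t] \<open>x > 0\<close> that s by (simp add: powr_minus field_simps)
        ultimately show "indicator ?A \<omega> \<le> ennreal (t powr s) * (\<Prod>i\<in>I. f i \<omega>)"
          by (auto simp: indicator_def x_def)
      qed
    qed
    also have "\<dots> = ennreal (t powr s) * ennreal c"
    proof -
      have [measurable]: "f i \<in> borel_measurable M" if "i \<in> I" for i
        using rv[OF that] unfolding f_def[abs_def] by measurable
      show ?thesis by (simp add: nn_integral_cmult int)
    qed
    finally have "prob ?A \<le> t powr s * c" using c by (simp flip: ennreal_mult)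
    also have "\<dots> \<le> (c + 1) * t powr s" by (simp add: algebra_simps)
    finally show ?thesis .
  qed
  with c show ?thesis by (intro exI[where x = "c + 1"]) auto
qed

text \<open>The single-entry lower bounds multiply by independence. Thresholds may differ between
  entries, so that a single weak hop per path can be prescribed.\<close>

lemma (in prob_space) prob_all_cn_less_ge:
  assumes I: "finite I" and ind: "indep_vars (\<lambda>_. borel) X I"
    and D: "\<And>i. i \<in> I \<Longrightarrow> distributed M lborel (X i) (\<lambda>z. ennreal (cn_density z))"
    and t: "\<And>i. i \<in> I \<Longrightarrow> 0 < t i \<and> t i \<le> 1"
  shows "exp (- real (card I)) * (\<Prod>i\<in>I. t i)
    \<le> prob {\<omega> \<in> space M. \<forall>i\<in>I. (cmod (X i \<omega>))\<^sup>2 < t i}"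
\<comment> \<open>The product rule for independent events asks for a nonempty index set.\<close>
proof (cases "I = {}")
  case True
  then show ?thesis by (simp add: prob_space)
next
  case False
  define A where "A i = {z. (cmod z)\<^sup>2 < t i}" for i
  have "exp (- real (card I)) * (\<Prod>i\<in>I. t i) = (\<Prod>i\<in>I. exp (- 1) * t i)"
    by (simp add: prod.distrib exp_of_nat_mult[symmetric])
  also have "\<dots> \<le> (\<Prod>i\<in>I. prob (X i -` A i \<inter> space M))"
  proof (intro prod_mono conjI)
    fix i assume i: "i \<in> I"
    show "0 \<le> exp (- 1) * t i" using t[OF i] by simp
    have "X i -` A i \<inter> space M = {\<omega> \<in> space M. (cmod (X i \<omega>))\<^sup>2 < t i}" by (auto simp: A_def)
    then show "exp (- 1) * t i \<le> prob (X i -` A i \<inter> space M)"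
      using prob_cn_ge[OF D[OF i]] t[OF i] by simp
  qed
  also have "\<dots> = prob (\<Inter>i\<in>I. X i -` A i \<inter> space M)"
  proof (rule indep_varsD_finite[OF ind False I, symmetric])
    show "A i \<in> sets borel" for i unfolding A_def by measurable
  qed
  also have "(\<Inter>i\<in>I. X i -` A i \<inter> space M) = {\<omega> \<in> space M. \<forall>i\<in>I. (cmod (X i \<omega>))\<^sup>2 < t i}"
    using False by (auto simp: A_def)
  finally show ?thesis .
qed

section \<open>Outage exponents\<close>

text \<open>
  The hypothesis \<open>R x / ln x \<longlongrightarrow> r\<close> covers both \<open>R x = r * ln x\<close> and, with \<open>r = 0\<close>, a constant rate;
  since \<open>R\<close> is bounded away from 0, \<open>exp (R x) - 1\<close> is comparable to \<open>exp (R x)\<close>.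
\<close>

lemma outage_exponentI:
  fixes K :: nat and p R :: "real \<Rightarrow> real"
  assumes R0: "R\<^sub>0 > 0" "eventually (\<lambda>x. R x \<ge> R\<^sub>0) at_top"
    and R: "((\<lambda>x. R x / ln x) \<longlongrightarrow> r) at_top"
    and c: "c > 0" "eventually (\<lambda>x. c * min 1 ((exp (R x) - 1) / x) ^ K \<le> p x) at_top"
    and le1: "\<And>x. p x \<le> 1"
    and C: "\<And>s. 0 < s \<Longrightarrow> s < 1 \<Longrightarrow>
      \<exists>C>0. eventually (\<lambda>x. p x \<le> C * (exp (real K * R x) / x ^ K) powr s) at_top"
  shows "outage_exponent p (real K * max 0 (1 - r))"
proof -
  \<comment> \<open>Chosen so that \<open>b * exp (R x) \<le> exp (R x) - 1\<close> whenever
    \<open>R x \<ge> R\<^sub>0\<close>.\<close>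
  define b where "b = 1 - exp (- R\<^sub>0)"
  have b: "0 < b" "b \<le> 1" using R0 by (auto simp: b_def)
  \<comment> \<open>For \<open>x > 0\<close>, \<open>exp (u x)\<close> is the assumed lower bound on
    \<open>p x\<close> after \<open>exp (R x) - 1\<close> is weakened to
    \<open>b * exp (R x)\<close> and \<open>b \<le> 1\<close> is pulled out of the minimum.\<close>
  define u where "u x = ln c + real K * (ln b + min 0 (R x - ln x))" for x
  have low: "eventually (\<lambda>x. p x > 0 \<and> u x \<le> ln (p x)) at_top"
    using R0(2) c(2) eventually_gt_at_top[of 1]
  proof eventually_elim
    case (elim x)
    have "b * exp (R x) \<le> exp (R x) - 1"
    proof -
      have "1 \<le> exp (R x - R\<^sub>0)" using elim by simp
      then show ?thesis by (simp add: b_def algebra_simps exp_diff exp_minus field_simps)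
    qed
    then have "b * exp (R x - ln x) \<le> (exp (R x) - 1) / x"
      using elim by (simp add: exp_diff field_simps)
    moreover have "b * exp (min 0 (R x - ln x)) \<le> b * exp (R x - ln x)"
      "b * exp (min 0 (R x - ln x)) \<le> b * 1"
      using b by (intro mult_left_mono; simp)+
    ultimately have m: "b * exp (min 0 (R x - ln x)) \<le> min 1 ((exp (R x) - 1) / x)"
      using b by linarith
    have "exp (u x) = c * (b * exp (min 0 (R x - ln x))) ^ K"
      using b c by (simp add: u_def exp_add exp_of_nat_mult power_mult_distrib)
    also have "\<dots> \<le> c * min 1 ((exp (R x) - 1) / x) ^ K"
      using m b c by (intro mult_left_mono power_mono) auto
    also have "\<dots> \<le> p x" using elim by simp
    finally have "exp (u x) \<le> p x" .
    moreover have "0 < exp (u x)" by simp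
    ultimately have "p x > 0" by linarith
    with \<open>exp (u x) \<le> p x\<close> show ?case by (simp add: ln_ge_iff)
  qed
  have inv_ln: "((\<lambda>x. a / ln x) \<longlongrightarrow> 0) at_top" for a :: real
    by (intro tendsto_divide_0[OF tendsto_const] filterlim_at_top_imp_at_infinity ln_at_top)
  \<comment> \<open>A lower bound on \<open>p\<close> bounds the exponent from above; division by
    \<open>ln x\<close> removes the constants \<open>c\<close> and \<open>b\<close>.\<close>
  have upper: "((\<lambda>x. - (u x / ln x)) \<longlongrightarrow> real K * max 0 (1 - r)) at_top"
  proof -
    have "((\<lambda>x. - ((ln c + real K * ln b) / ln x + real K * min 0 (R x / ln x - 1)))
        \<longlongrightarrow> - (0 + real K * min 0 (r - 1))) at_top"
      by (intro tendsto_intros inv_ln R)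
    moreover have "- (0 + real K * min 0 (r - 1)) = real K * max 0 (1 - r)"
      by (simp add: min_def max_def algebra_simps)
    moreover have "eventually (\<lambda>x. - ((ln c + real K * ln b) / ln x + real K * min 0 (R x / ln x - 1))
        = - (u x / ln x)) at_top"
      using eventually_gt_at_top[of 1]
    proof eventually_elim
      case (elim x)
      then have "ln x > 0" by simp
      then have "min 0 (R x / ln x - 1) = min 0 (R x - ln x) / ln x"
        by (simp add: min_def field_simps)
      with \<open>ln x > 0\<close> show ?case by (simp add: u_def field_simps)
    qed
    ultimately show ?thesis by (simp cong: filterlim_cong add: tendsto_cong)
  qed
  have lower: "eventually (\<lambda>x. y < - (ln (p x) / ln x)) at_top" if y: "y < real K * max 0 (1 - r)" for y
  \<comment> \<open>For \<open>y < 0\<close> the bound \<open>p x \<le> 1\<close> suffices, which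
    settles \<open>r \<ge> 1\<close>, where the target is 0. Otherwise \<open>r < 1\<close>, and the
    power bound applies.\<close>
  proof (cases "y < 0")
    case True
    show ?thesis using low eventually_gt_at_top[of 1]
    proof eventually_elim
      case (elim x)
      then have "ln (p x) \<le> 0" using le1[of x] by (simp add: ln_le_zero_iff)
      then have "ln (p x) / ln x \<le> 0" using elim by (simp add: divide_nonpos_pos)
      then show ?case using True by linarith
    qed
  next
    case False
    then have "real K * max 0 (1 - r) > 0" using y by linarith
    then have pos: "real K * (1 - r) > 0" "r < 1" and y': "y < real K * (1 - r)"
      using y by (auto simp: max_def zero_less_mult_iff split: if_splits)
    \<comment> \<open>Close enough to 1 that \<open>s * K * (1 - r)\<close> still exceeds
      \<open>y\<close>.\<close>
    obtain s where s: "y / (real K * (1 - r)) < s" "s < 1"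
      using dense[of "y / (real K * (1 - r))" 1] y' pos by auto
    then have "s > 0" using False pos by (meson divide_nonneg_pos le_less_trans not_less)
    then obtain C where C': "C > 0"
      "eventually (\<lambda>x. p x \<le> C * (exp (real K * R x) / x ^ K) powr s) at_top"
      using C s by blast
    have "((\<lambda>x. - (ln C / ln x + s * real K * (R x / ln x - 1)))
        \<longlongrightarrow> - (0 + s * real K * (r - 1))) at_top"
      by (intro tendsto_intros inv_ln R)
    moreover have "y < - (0 + s * real K * (r - 1))"
      using s(1) pos by (simp add: field_simps)
    ultimately have "eventually (\<lambda>x. y < - (ln C / ln x + s * real K * (R x / ln x - 1))) at_top"
      by (rule order_tendstoD)
    with C'(2) low show ?thesis using eventually_gt_at_top[of 1]
    proof eventually_elim
      case (elim x)
      have "exp (real K * R x) / x ^ K = exp (real K * (R x - ln x))"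
        using elim by (simp add: right_diff_distrib exp_diff exp_of_nat_mult)
      then have "(exp (real K * R x) / x ^ K) powr s = exp (s * (real K * (R x - ln x)))"
        by (simp add: powr_def)
      then have "ln (p x) \<le> ln (C * exp (s * (real K * (R x - ln x))))"
        using elim C' by (intro ln_mono) auto
      also have "\<dots> = ln C + s * (real K * (R x - ln x))"
        using C' by (simp add: ln_mult)
      finally have "ln (p x) / ln x \<le> (ln C + s * (real K * (R x - ln x))) / ln x"
        using elim by (intro divide_right_mono) auto
      also have "\<dots> = ln C / ln x + s * real K * (R x / ln x - 1)"
        using elim by (simp add: field_simps)
      finally show ?case using elim by linarith
    qed
  qed
  have "((\<lambda>x. - (ln (p x) / ln x)) \<longlongrightarrow> real K * max 0 (1 - r)) at_top"
  proof (rule order_tendstoI)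
    fix y assume "real K * max 0 (1 - r) < y"
    with upper have "eventually (\<lambda>x. - (u x / ln x) < y) at_top" by (rule order_tendstoD)
    with low show "eventually (\<lambda>x. - (ln (p x) / ln x) < y) at_top"
      using eventually_gt_at_top[of 1]
    proof eventually_elim
      case (elim x)
      then have "u x / ln x \<le> ln (p x) / ln x" by (intro divide_right_mono) auto
      with elim show ?case by linarith
    qed
  qed (rule lower)
  then show ?thesis
    unfolding outage_exponent_def using low by (auto elim: eventually_mono)
qed

text \<open>The outage event becomes one about the scalars \<open>Y k\<close>; the two Gaussian
  product estimates then supply the bounds that \<open>outage_exponentI\<close> asks for. The map
  \<open>p\<close> numbers the paths.\<close>

lemma (in prob_space) has_dmt_scalar_products:
  fixes K N :: nat and X :: "nat \<times> nat \<Rightarrow> 'a \<Rightarrow> complex" and G :: "'k \<Rightarrow> 'a \<Rightarrow> complex mat"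
  assumes N: "N \<ge> 1" and p: "inj_on p {..<K}" and J: "\<P> = p ` {..<K}"
    and ind: "indep_vars (\<lambda>_. borel) X ({..<K} \<times> {1..N})"
    and D: "\<And>e. e \<in> {..<K} \<times> {1..N} \<Longrightarrow> distributed M lborel (X e) (\<lambda>z. ennreal (cn_density z))"
    and G: "\<And>k \<omega>. k < K \<Longrightarrow> \<omega> \<in> space M \<Longrightarrow> G (p k) \<omega> \<in> carrier_mat 1 1 \<and>
      G (p k) \<omega> $$ (0, 0) = (\<Prod>i=1..N. X (k, i) \<omega>)"
    and K: "K > 0"
  shows "has_dmt M \<P> G (\<lambda>r. real K * max 0 (1 - r))"
proof -
  let ?I = "{..<K} \<times> {1..N}"
  define Y where "Y k \<omega> = (\<Prod>i=1..N. (cmod (X (k, i) \<omega>))\<^sup>2)" for k \<omega>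
  have Y0: "Y k \<omega> \<ge> 0" for k \<omega> unfolding Y_def by (intro prod_nonneg) simp
  have rv [measurable]: "X e \<in> borel_measurable M" if "e \<in> ?I" for e
    using ind that by (auto simp: indep_vars_def)
  have [measurable]: "Y k \<in> borel_measurable M" if "k < K" for k
    unfolding Y_def[abs_def]
  proof (rule borel_measurable_prod)
    fix i assume "i \<in> {1..N}"
    then have [measurable]: "X (k, i) \<in> borel_measurable M" using that by (intro rv) auto
    show "(\<lambda>\<omega>. (cmod (X (k, i) \<omega>))\<^sup>2) \<in> borel_measurable M" by measurable
  qed
  have cardP: "card \<P> = K" using p J by (simp add: card_image)
  define P where "P x R = prob {\<omega> \<in> space M. (\<Sum>k<K. ln (1 + x * Y k \<omega>)) < real K * R}" for x R
  have outage: "outage_prob M \<P> G x R = P x R" for x R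
  proof -
    have "(\<Sum>k\<in>\<P>. log_det x (G k \<omega>)) = (\<Sum>k<K. ln (1 + x * Y k \<omega>))" if "\<omega> \<in> space M" for \<omega>
    proof -
      have "(\<Sum>k\<in>\<P>. log_det x (G k \<omega>)) = (\<Sum>k<K. log_det x (G (p k) \<omega>))"
        unfolding J by (rule sum.reindex_cong[OF p]) auto
      also have "\<dots> = (\<Sum>k<K. ln (1 + x * Y k \<omega>))"
        using G that by (intro sum.cong) (auto simp: log_det_scalar Y_def prod_norm[symmetric] prod_power_distrib)
      finally show ?thesis .
    qed
    then show ?thesis
      unfolding outage_prob_def P_def cardP by (intro arg_cong[where f = prob]) auto
  qed
  have lower: "exp (- real (K * N)) * min 1 ((exp R - 1) / x) ^ K \<le> P x R"
    if x: "x > 0" and R: "R > 0" for x R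
  proof -
    define t where "t = min 1 ((exp R - 1) / x)"
    have t: "0 < t" "t \<le> 1" using x R by (auto simp: t_def)
    \<comment> \<open>Only the first hop of each path is made weak. The other thresholds are 1, so
      the product of all of them is \<open>t ^ K\<close> and not \<open>t ^ (K * N)\<close>.\<close>
    define \<tau> where "\<tau> = (\<lambda>(k :: nat, i :: nat). if i = 1 then t else 1)"
    have "(\<Prod>e\<in>?I. \<tau> e) = (\<Prod>k<K. \<Prod>i\<in>{1..N}. \<tau> (k, i))"
      by (simp add: prod.cartesian_product)
    also have "\<dots> = t ^ K"
      using N by (simp add: \<tau>_def prod.delta)
    finally have "exp (- real (K * N)) * t ^ K
        = exp (- real (card ?I)) * (\<Prod>e\<in>?I. \<tau> e)"
      by simp
    also have "\<dots> \<le> prob {\<omega> \<in> space M. \<forall>e\<in>?I. (cmod (X e \<omega>))\<^sup>2 < \<tau> e}"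
      using t by (intro prob_all_cn_less_ge ind D) (auto simp: \<tau>_def)
    also have "\<dots> \<le> P x R"
      unfolding P_def
    proof (intro finite_measure_mono subsetI)
      fix \<omega> assume \<omega>: "\<omega> \<in> {\<omega> \<in> space M. \<forall>e\<in>?I. (cmod (X e \<omega>))\<^sup>2 < \<tau> e}"
      have "ln (1 + x * Y k \<omega>) < R" if k: "k < K" for k
      proof -
        have "Y k \<omega> = (cmod (X (k, 1) \<omega>))\<^sup>2 * (\<Prod>i\<in>{1..N} - {1}. (cmod (X (k, i) \<omega>))\<^sup>2)"
          unfolding Y_def using N by (intro prod.remove) auto
        also have "\<dots> \<le> (cmod (X (k, 1) \<omega>))\<^sup>2 * 1"
        proof (intro mult_left_mono prod_le_1 conjI)
          fix i assume "i \<in> {1..N} - {1}"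
          with \<omega> k have "(cmod (X (k, i) \<omega>))\<^sup>2 < \<tau> (k, i)" "i \<noteq> 1" by auto
          then show "(cmod (X (k, i) \<omega>))\<^sup>2 \<le> 1" by (simp add: \<tau>_def)
        qed auto
        also have "(cmod (X (k, 1) \<omega>))\<^sup>2 < \<tau> (k, 1)" using \<omega> k N by auto
        also have "\<tau> (k, 1) \<le> (exp R - 1) / x" by (simp add: \<tau>_def t_def)
        finally have "1 + x * Y k \<omega> < exp R" using x by (simp add: field_simps)
        moreover have "1 + x * Y k \<omega> > 0" using x Y0[of k \<omega>] by (simp add: add_pos_nonneg)
        ultimately show ?thesis by (metis ln_exp ln_less_cancel_iff exp_gt_zero)
      qed
      then have "(\<Sum>k<K. ln (1 + x * Y k \<omega>)) < (\<Sum>k<K. R)"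
        using K by (intro sum_strict_mono) auto
      then show "\<omega> \<in> {\<omega> \<in> space M. (\<Sum>k<K. ln (1 + x * Y k \<omega>)) < real K * R}"
        using \<omega> by simp
    next
      show "{\<omega> \<in> space M. (\<Sum>k<K. ln (1 + x * Y k \<omega>)) < real K * R} \<in> events"
        by measurable
    qed
    finally show ?thesis unfolding t_def .
  qed
  have upper: "\<exists>C>0. \<forall>x>0. \<forall>R. P x R \<le> C * (exp (real K * R) / x ^ K) powr s"
    if s: "0 < s" "s < 1" for s
  proof -
    obtain C where C: "C > 0"
      "\<And>t. t > 0 \<Longrightarrow> prob {\<omega> \<in> space M. (\<Prod>e\<in>?I. (cmod (X e \<omega>))\<^sup>2) \<le> t} \<le> C * t powr s"
      using prob_prod_cn_le[OF _ ind D s] by auto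
    have "P x R \<le> C * (exp (real K * R) / x ^ K) powr s" if x: "x > 0" for x R
    proof -
      have "P x R \<le> prob {\<omega> \<in> space M. (\<Prod>e\<in>?I. (cmod (X e \<omega>))\<^sup>2) \<le> exp (real K * R) / x ^ K}"
        unfolding P_def
      proof (intro finite_measure_mono subsetI)
        fix \<omega> assume \<omega>: "\<omega> \<in> {\<omega> \<in> space M. (\<Sum>k<K. ln (1 + x * Y k \<omega>)) < real K * R}"
        have pos: "1 + x * Y k \<omega> > 0" for k using x Y0[of k \<omega>] by (simp add: add_pos_nonneg)
        \<comment> \<open>Dropping the 1 from each \<open>1 + x * Y k \<omega>\<close> turns outage
          into smallness of one product over all paths and hops.\<close>
        have "x ^ K * (\<Prod>k<K. Y k \<omega>) = (\<Prod>k<K. x * Y k \<omega>)" by (simp add: prod.distrib)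
        also have "\<dots> \<le> (\<Prod>k<K. 1 + x * Y k \<omega>)" using x Y0 by (intro prod_mono) auto
        also have "\<dots> = exp (\<Sum>k<K. ln (1 + x * Y k \<omega>))" using pos by (simp add: exp_sum)
        also have "\<dots> \<le> exp (real K * R)" using \<omega> by simp
        finally have "(\<Prod>k<K. Y k \<omega>) \<le> exp (real K * R) / x ^ K" using x by (simp add: field_simps)
        moreover have "(\<Prod>k<K. Y k \<omega>) = (\<Prod>e\<in>?I. (cmod (X e \<omega>))\<^sup>2)"
          unfolding Y_def by (simp add: prod.cartesian_product case_prod_unfold)
        ultimately show "\<omega> \<in> {\<omega> \<in> space M. (\<Prod>e\<in>?I. (cmod (X e \<omega>))\<^sup>2) \<le> exp (real K * R) / x ^ K}"
          using \<omega> by simp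
      qed measurable
      also have "\<dots> \<le> C * (exp (real K * R) / x ^ K) powr s" using x by (intro C) simp
      finally show ?thesis .
    qed
    with C show ?thesis by blast
  qed
  \<comment> \<open>Serves both rate regimes: the growing rate with \<open>R\<^sub>0 = r\<close>, as
    \<open>ln x \<ge> 1\<close> for \<open>x \<ge> exp 1\<close>, and the constant rate
    \<open>R\<close> with \<open>R\<^sub>0 = R\<close> and limit 0.\<close>
  have main: "outage_exponent (\<lambda>x. outage_prob M \<P> G x (R x)) (real K * max 0 (1 - r))"
    if R0: "R\<^sub>0 > 0" "eventually (\<lambda>x. R x \<ge> R\<^sub>0) at_top" and R: "((\<lambda>x. R x / ln x) \<longlongrightarrow> r) at_top"
    for R R\<^sub>0 r
    unfolding outage
  proof (rule outage_exponentI[OF R0 R, where c = "exp (- real (K * N))"])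
    show "eventually (\<lambda>x. exp (- real (K * N)) * min 1 ((exp (R x) - 1) / x) ^ K \<le> P x (R x)) at_top"
      using R0(2) eventually_gt_at_top[of 0]
    proof eventually_elim
      case (elim x)
      with R0(1) show ?case by (intro lower) auto
    qed
    show "P x (R x) \<le> 1" for x by (simp add: P_def)
    show "\<exists>C>0. eventually (\<lambda>x. P x (R x) \<le> C * (exp (real K * R x) / x ^ K) powr s) at_top"
      if "0 < s" "s < 1" for s
    proof -
      from upper[OF that] obtain C where "C > 0"
        "\<forall>x>0. \<forall>R. P x R \<le> C * (exp (real K * R) / x ^ K) powr s" by blast
      then show ?thesis
        by (intro exI[where x = C]) (auto intro!: eventually_mono[OF eventually_gt_at_top[of 0]])
    qed
  qed simp
  show ?thesis
    unfolding has_dmt_def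
  proof (intro conjI allI impI)
    fix r :: real assume r: "r > 0"
    have "eventually (\<lambda>x. r \<le> r * ln x) at_top"
      using eventually_ge_at_top[of "exp 1"]
    proof eventually_elim
      case (elim x)
      then have "1 \<le> ln x" by (subst ln_ge_iff) (auto intro: less_le_trans[OF exp_gt_zero])
      with r show ?case by simp
    qed
    moreover have "((\<lambda>x. r * ln x / ln x) \<longlongrightarrow> r) at_top"
    proof (rule tendsto_eventually)
      show "eventually (\<lambda>x. r * ln x / ln x = r) at_top"
        using eventually_gt_at_top[of 1] by eventually_elim simp
    qed
    ultimately show "outage_exponent (\<lambda>x. outage_prob M \<P> G x (r * ln x)) (real K * max 0 (1 - r))"
      by (rule main[OF r])
  next
    fix R :: real assume R: "R > 0"
    have "((\<lambda>x. R / ln x) \<longlongrightarrow> 0) at_top"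
      by (intro tendsto_divide_0[OF tendsto_const] filterlim_at_top_imp_at_infinity ln_at_top)
    then show "outage_exponent (\<lambda>x. outage_prob M \<P> G x R) (real K * max 0 (1 - 0))"
      by (intro main[OF R]) auto
  qed
qed

section \<open>From node paths to the parallel partition and its DMT\<close>

theorem mainTheorem8:
  fixes N :: nat and n :: "nat \<Rightarrow> nat"
  assumes "N \<ge> 1"
    and "\<And>i. i \<le> N \<Longrightarrow> n i > 0"
  shows "\<exists>S \<P>. parallel_partition N n S \<P> \<and> independent_paths N \<P> \<and>
    (\<forall>(M :: 'w measure) H. multihop_channel N n M H \<longrightarrow>
       has_dmt M \<P> (\<lambda>P \<omega>. path_channel (\<lambda>i. H i \<omega>) P N)
         (\<lambda>r. real (Min ((\<lambda>i. n (i - 1) * n i) ` {1..N})) * max 0 (1 - r)))"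
proof -
  define K where "K = Min ((\<lambda>i. n (i - 1) * n i) ` {1..N})"
  have "K \<in> (\<lambda>i. n (i - 1) * n i) ` {1..N}" unfolding K_def using assms(1) by (intro Min_in) auto
  then have K: "K > 0" using assms(2) by auto
  have "K \<le> n i * n (Suc i)" if "i < N" for i
    unfolding K_def using that by (intro Min_le) (auto intro!: image_eqI[where x = "Suc i"])
  with ex_edge_disjoint_node_paths[of N n K] assms(2) obtain c :: "nat \<Rightarrow> nat \<Rightarrow> nat"
    where c: "\<And>i k. i \<le> N \<Longrightarrow> k < K \<Longrightarrow> c i k < n i"
      and c_inj: "\<And>i. i < N \<Longrightarrow> inj_on (\<lambda>k. (c i k, c (Suc i) k)) {..<K}" by blast
  \<comment> \<open>The restriction to layers up to \<open>N\<close> makes \<open>p k\<close>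
    extensional, as \<open>AF_paths\<close> demands.\<close>
  define p where "p k = (\<lambda>i\<in>{..N}. {c i k})" for k
  define S where "S i = (\<lambda>v. {v}) ` {..<n i}" for i
  \<comment> \<open>An edge determines the path through it. Distinctness of the paths, independence
    of the partition and injectivity of \<open>f\<close> below all rest on this.\<close>
  have edge_eq: "k = l" if "k < K" "l < K" "i \<in> {1..N}" "c i k = c i l" "c (i - 1) k = c (i - 1) l" for i k l
  proof -
    have "inj_on (\<lambda>k. (c (i - 1) k, c (Suc (i - 1)) k)) {..<K}"
      using that(3) by (intro c_inj) auto
    moreover have "Suc (i - 1) = i" using that(3) by simp
    ultimately have "inj_on (\<lambda>k. (c (i - 1) k, c i k)) {..<K}" by (simp only:)
    then show ?thesis by (rule inj_onD) (use that in auto)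
  qed
  have p_inj: "inj_on p {..<K}"
  proof (rule inj_onI)
    fix k l assume *: "k \<in> {..<K}" "l \<in> {..<K}" "p k = p l"
    have "c i k = c i l" if "i \<le> N" for i
      using fun_cong[OF *(3), of i] that by (simp add: p_def)
    \<comment> \<open>The first hop, which exists because \<open>N \<ge> 1\<close>, already
      separates two paths.\<close>
    then show "k = l" using edge_eq[of k l 1] * assms(1) by auto
  qed
  have "partition_on {..<n i} (S i)" for i
    unfolding S_def by (auto simp: partition_on_def disjoint_def)
  then have part: "parallel_partition N n S (p ` {..<K})"
    using K c unfolding parallel_partition_def supernode_partition_def AF_paths_def
    by (auto simp: p_def S_def)
  have indep: "independent_paths N (p ` {..<K})"
    unfolding independent_paths_def pairwise_def path_edges_def
  proof (intro ballI impI)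
    fix P Q assume "P \<in> p ` {..<K}" "Q \<in> p ` {..<K}" "P \<noteq> Q"
    then obtain k l where kl: "k < K" "l < K" "P = p k" "Q = p l" "k \<noteq> l" by auto
    have "\<not> (e \<in> (SIGMA i:{1..N}. P i \<times> P (i - 1)) \<and> e \<in> (SIGMA i:{1..N}. Q i \<times> Q (i - 1)))" for e
    proof (cases e)
      case (fields i a b)
      then show ?thesis using edge_eq[of k l i] kl by (auto simp: p_def)
    qed
    then show "(SIGMA i:{1..N}. P i \<times> P (i - 1)) \<inter> (SIGMA i:{1..N}. Q i \<times> Q (i - 1)) = {}"
      by blast
  qed
  have "has_dmt M (p ` {..<K}) (\<lambda>P \<omega>. path_channel (\<lambda>i. H i \<omega>) P N) (\<lambda>r. real K * max 0 (1 - r))"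
    if mc: "multihop_channel N n M H" for M :: "'w measure" and H
  proof -
    interpret prob_space M using mc by (simp add: multihop_channel_def)
    \<comment> \<open>Sends a path and a hop to the edge used there, so the gains are distinct
      channel entries and inherit their independence.\<close>
    define f where "f = (\<lambda>(k, i). (i, c i k, c (i - 1) k))"
    let ?X = "\<lambda>(i, a, b) \<omega>. H i \<omega> $$ (a, b)"
    have f_inj: "inj_on f ({..<K} \<times> {1..N})"
      by (rule inj_onI) (use edge_eq in \<open>auto simp: f_def\<close>)
    have f_img: "f ` ({..<K} \<times> {1..N}) \<subseteq> (SIGMA i:{1..N}. {..<n i} \<times> {..<n (i - 1)})"
      using c by (auto simp: f_def)
    have "indep_vars (\<lambda>_. borel) ?X (SIGMA i:{1..N}. {..<n i} \<times> {..<n (i - 1)})"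
      using mc by (simp add: multihop_channel_def)
    from indep_vars_reindex[OF f_inj indep_vars_subset[OF this f_img]]
    have "indep_vars (\<lambda>_. borel) (\<lambda>e. ?X (f e)) ({..<K} \<times> {1..N})" .
    then show ?thesis
    proof (rule has_dmt_scalar_products[OF assms(1) p_inj refl])
      fix e assume "e \<in> {..<K} \<times> {1..N}"
      then show "distributed M lborel (?X (f e)) (\<lambda>z. ennreal (cn_density z))"
        using mc c by (auto simp: f_def multihop_channel_def)
    next
      fix k \<omega> assume k: "k < K" and \<omega>: "\<omega> \<in> space M"
      show "path_channel (\<lambda>i. H i \<omega>) (p k) N \<in> carrier_mat 1 1 \<and>
        path_channel (\<lambda>i. H i \<omega>) (p k) N $$ (0, 0) = (\<Prod>i=1..N. ?X (f (k, i)) \<omega>)"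
        using path_channel_singletons[of N "p k" "\<lambda>i. c i k" n "\<lambda>i. H i \<omega>"] mc c k \<omega>
        by (auto simp: p_def f_def multihop_channel_def)
    qed (rule K)
  qed
  with part indep show ?thesis unfolding K_def by blast
qed

end
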